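(* Let $g \in C^2(\mathbb{R})$ satisfy $g''(t) > 0$ for all $t\in\mathbb{R}$ and $g(0)=g'(0)=0$, and let $$K^g_{\mathrm{stat}} = \left\{ \begin{pmatrix} X \\ g'(\det X)X \\ \big(g'(\det X)\det X - g(\det X)\big)J \end{pmatrix} : X \in \mathbb{R}^{2\times 2}\right\} \subset \mathbb{R}^{6\times 2}, \qquad J = \begin{pmatrix} 0 & -1 \\ 1 & 0\end{pmatrix}.$$ Then the quasiconvex hull of $K^g_{\mathrm{stat}}$ is trivial: $$(K^g_{\mathrm{stat}})^{qc} = K^g_{\mathrm{stat}}.$$
   Context: For $K\subset\mathbb{R}^{n\times m}$, the quasiconvex hull is $K^{qc} = \{X\in\mathbb{R}^{n\times m} : X = \langle\nu,\mathrm{id}\rangle \text{ for some homogeneous gradient Young measure } \nu \text{ with } \operatorname{spt}(\nu)\subset K\}$, where $\langle\nu,\mathrm{id}\rangle = \int_{\mathbb{R}^{n\times m}} A\,d\nu(A)$. Here a probability measure $\nu$ on $\mathbb{R}^{n\times m}$ is a homogeneous gradient Young measure if there are an open, bounded, convex $\Omega\subset\mathbb{R}^m$ and an equi-Lipschitz, uniformly bounded sequence $u_j:\Omega\to\mathbb{R}^n$ such that for every continuous $F:\mathbb{R}^{n\times m}\to\mathbb{R}$ the functions $F(Du_j)$ converge weakly-$*$ in $L^\infty(\Omega)$ to the constant $\int F\,d\nu$. *)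

theory Defs
  imports "HOL-Probability.Probability"
begin

text \<open>
  An \<open>n \<times> m\<close> matrix is an element of \<open>real^'m^'n\<close>: the index type \<open>'n\<close> enumerates its rows.
\<close>

definition measure_support :: "'a::topological_space measure \<Rightarrow> 'a set" where
  "measure_support M = {x. \<forall>U. open U \<and> x \<in> U \<longrightarrow> emeasure M U > 0}"

definition in_Linfty :: "'a::euclidean_space set \<Rightarrow> ('a \<Rightarrow> real) \<Rightarrow> bool" where
  "in_Linfty \<Omega> f \<longleftrightarrow>
     f \<in> borel_measurable (lebesgue_on \<Omega>) \<and>
     (\<exists>C. AE x in lebesgue_on \<Omega>. \<bar>f x\<bar> \<le> C)"

text \<open>Test functions range over the predual \<open>L\<^sup>1(\<Omega>)\<close>.\<close>

definition weak_star_Linfty ::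
    "'a::euclidean_space set \<Rightarrow> (nat \<Rightarrow> 'a \<Rightarrow> real) \<Rightarrow> ('a \<Rightarrow> real) \<Rightarrow> bool" where
  "weak_star_Linfty \<Omega> f l \<longleftrightarrow>
     (\<forall>j. in_Linfty \<Omega> (f j)) \<and> in_Linfty \<Omega> l \<and>
     (\<forall>\<phi>. integrable (lebesgue_on \<Omega>) \<phi> \<longrightarrow>
        (\<lambda>j. LINT x|lebesgue_on \<Omega>. f j x * \<phi> x)
          \<longlonglongrightarrow> (LINT x|lebesgue_on \<Omega>. l x * \<phi> x))"

text \<open>
  The gradient \<open>Du\<close> of a Lipschitz map is only determined up to null sets; \<open>G\<close> is a
  representative of it.  On an open set one exists for every Lipschitz \<open>u\<close>, by Rademacher's
  theorem.
\<close>

definition is_gradient_on ::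
    "(real^'m) set \<Rightarrow> (real^'m \<Rightarrow> real^'n) \<Rightarrow> (real^'m \<Rightarrow> real^'m^'n) \<Rightarrow> bool" where
  "is_gradient_on \<Omega> u G \<longleftrightarrow>
     (AE x in lebesgue_on \<Omega>. (u has_derivative (\<lambda>h. G x *v h)) (at x))"

text \<open>
  \<open>\<Omega>\<close> must be nonempty: on the empty set the convergence requirement is vacuous.
  The maps \<open>u j\<close> are total, but only their restrictions to \<open>\<Omega>\<close> matter.
\<close>

definition homogeneous_gradient_young_measure :: "(real^'m^'n) measure \<Rightarrow> bool" where
  "homogeneous_gradient_young_measure \<nu> \<longleftrightarrow>
     prob_space \<nu> \<and> sets \<nu> = sets borel \<and>
     (\<exists>(\<Omega> :: (real^'m) set) (u :: nat \<Rightarrow> real^'m \<Rightarrow> real^'n) Du.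
        open \<Omega> \<and> bounded \<Omega> \<and> convex \<Omega> \<and> \<Omega> \<noteq> {} \<and>
        (\<exists>L. \<forall>j. L-lipschitz_on \<Omega> (u j)) \<and>
        (\<exists>C. \<forall>j. \<forall>x\<in>\<Omega>. norm (u j x) \<le> C) \<and>
        (\<forall>j. is_gradient_on \<Omega> (u j) (Du j)) \<and>
        (\<forall>F :: real^'m^'n \<Rightarrow> real. continuous_on UNIV F \<longrightarrow>
           weak_star_Linfty \<Omega> (\<lambda>j x. F (Du j x)) (\<lambda>x. LINT A|\<nu>. F A)))"

definition quasiconvex_hull :: "(real^'m^'n) set \<Rightarrow> (real^'m^'n) set" where
  "quasiconvex_hull K =
     {X. \<exists>\<nu>. homogeneous_gradient_young_measure \<nu> \<and> measure_support \<nu> \<subseteq> K \<and>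
             X = (LINT A|\<nu>. A)}"

definition J_matrix :: "real^2^2" where
  "J_matrix = vector [vector [0, -1], vector [1, 0]]"

definition stack3 :: "real^2^2 \<Rightarrow> real^2^2 \<Rightarrow> real^2^2 \<Rightarrow> real^2^6" where
  "stack3 A B C = vector [A $ 1, A $ 2, B $ 1, B $ 2, C $ 1, C $ 2]"

lemma stack3_nth:
  "stack3 A B C $ 1 = A $ 1" "stack3 A B C $ 2 = A $ 2"
  "stack3 A B C $ 3 = B $ 1" "stack3 A B C $ 4 = B $ 2"
  "stack3 A B C $ 5 = C $ 1" "stack3 A B C $ 6 = C $ 2"
  by (simp_all add: stack3_def vector_def)

definition K_stat :: "(real \<Rightarrow> real) \<Rightarrow> (real^2^6) set" where
  "K_stat g =
     {stack3 X (deriv g (det X) *\<^sub>R X)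
             ((deriv g (det X) * det X - g (det X)) *\<^sub>R J_matrix) | X. True}"

end

theory Submission
  imports Defs "HOL-Complex_Analysis.Great_Picard"
begin

text \<open>
  The \<open>2 \<times> 2\<close> minors commute with the barycenter of a homogeneous gradient Young measure \<open>\<nu>\<close>.  On
  \<open>K_stat g\<close> write \<open>t = det X\<close>, \<open>s = g'(t)\<close> and \<open>h(t) = g'(t) t - g(t)\<close>.  The third block is \<open>h J\<close>, with
  determinant \<open>h\<^sup>2\<close>, so \<open>h\<close> has zero variance under \<open>\<nu>\<close>.  As \<open>h'(t) = t g''(t)\<close>, a nonzero level of \<open>h\<close>
  has at most one point on either side of the origin.  The Pluecker relation between the minors of
  the first two blocks reads \<open>E[t] E[s\<^sup>2 t] = E[s t]\<^sup>2\<close>, which excludes a genuine mixture of the two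
  points.  Hence \<open>t\<close> is constant, the blocks depend linearly on \<open>X\<close>, and the barycenter lies in
  \<open>K_stat g\<close>.
\<close>

section \<open>Integrals of compactly supported functions\<close>

lemma lborel_integral_translate:
  fixes F :: "'a::euclidean_space \<Rightarrow> real"
  assumes "F \<in> borel_measurable borel"
  shows "(LINT x|lborel. F (x + c)) = (LINT x|lborel. F x)"
proof -
  have "(LINT x|lborel. F x) = (LINT x|distr lborel borel ((+) c). F x)"
    by (simp add: lborel_distr_plus)
  also have "\<dots> = (LINT x|lborel. F (c + x))"
    using assms by (intro integral_distr) auto
  finally show ?thesis by (simp add: add.commute)
qed

lemma lborel_integrable_compact_support:
  fixes F :: "'a::euclidean_space \<Rightarrow> real"
  assumes "continuous_on UNIV F" "compact S" "\<And>x. x \<notin> S \<Longrightarrow> F x = 0"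
  shows "integrable lborel F"
proof -
  have "integrable lborel (\<lambda>x. indicator S x *\<^sub>R F x)"
    using assms by (intro borel_integrable_compact) (auto intro: continuous_on_subset)
  moreover have "(\<lambda>x. indicator S x *\<^sub>R F x) = F"
    using assms(3) by (auto simp: indicator_def fun_eq_iff)
  ultimately show ?thesis by simp
qed

text \<open>Weak-* limits live over \<open>lebesgue_on \<Omega>\<close>, while summation by parts
  rests on translation invariance of \<open>lborel\<close>. Extension by zero lets an integrand pass
  from one to the other.\<close>

lemma lebesgue_on_integral_eq_lborel:
  fixes F :: "'a::euclidean_space \<Rightarrow> real"
  assumes "F \<in> borel_measurable borel" "\<Omega> \<in> sets lebesgue" "\<And>x. x \<notin> \<Omega> \<Longrightarrow> F x = 0"
  shows "(LINT x|lebesgue_on \<Omega>. F x) = (LINT x|lborel. F x)"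
proof -
  have "(LINT x|lebesgue_on \<Omega>. F x) = (LINT x|lebesgue. indicator \<Omega> x *\<^sub>R F x)"
    using assms by (intro integral_restrict_space) auto
  also have "(\<lambda>x. indicator \<Omega> x *\<^sub>R F x) = F"
    using assms(3) by (auto simp: indicator_def fun_eq_iff)
  also have "(LINT x|lebesgue. F x) = (LINT x|lborel. F x)"
    using assms by (intro integral_completion) auto
  finally show ?thesis .
qed

section \<open>Difference quotients and Jacobian integrals\<close>

text \<open>Restriction to the line through \<open>x\<close> in direction \<open>a\<close> reduces
  this to one variable. The steps may have either sign, so that backward quotients are covered as
  well.\<close>

lemma has_derivative_quotient_LIMSEQ:
  fixes f :: "'a::real_normed_vector \<Rightarrow> real"
  assumes f: "(f has_derivative f') (at x)" and h: "h \<longlonglongrightarrow> 0" "\<And>n. h n \<noteq> 0"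
  shows "(\<lambda>n. (f (x + h n *\<^sub>R a) - f x) / h n) \<longlonglongrightarrow> f' a"
proof -
  have f'': "(f has_derivative f') (at (x + 0 *\<^sub>R a))" using f by simp
  have "((\<lambda>t. f (x + t *\<^sub>R a)) has_derivative (\<lambda>t. f' (t *\<^sub>R a))) (at (0::real))"
  proof -
    have "((\<lambda>t. x + t *\<^sub>R a) has_derivative (\<lambda>t. t *\<^sub>R a)) (at (0::real))"
      by (auto intro!: derivative_eq_intros)
    from has_derivative_compose[OF this f''] show ?thesis by simp
  qed
  moreover have "f' (t *\<^sub>R a) = f' a * t" for t
    using f linear_cmul[OF has_derivative_linear] by fastforce
  ultimately have "((\<lambda>t. f (x + t *\<^sub>R a)) has_field_derivative f' a) (at 0)"
    by (simp add: has_field_derivative_def)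
  then have "((\<lambda>t. (f (x + t *\<^sub>R a) - f x) / t) \<longlongrightarrow> f' a) (at 0)"
    by (simp add: has_field_derivative_iff)
  then show ?thesis
    using h unfolding tendsto_at_iff_sequentially by (auto simp: o_def)
qed

text \<open>
  The two products of difference quotients step in opposite directions; with this choice the
  second differences of \<open>g\<close> cancel after summation by parts, and only \<open>\<phi>\<close> gets differenced.
\<close>

lemma discrete_jacobian_bound:
  fixes f g \<phi> :: "'a::euclidean_space \<Rightarrow> real"
  assumes f: "continuous_on UNIV f" "\<And>x. \<bar>f x\<bar> \<le> e"
    and g: "M-lipschitz_on UNIV g" and \<phi>: "K-lipschitz_on UNIV \<phi>"
    and supp: "\<And>x. x \<notin> cball x0 r \<Longrightarrow> \<phi> x = 0"
    and ab: "norm a \<le> 1" "norm b \<le> 1" and h: "0 < h" "h \<le> 1"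
  shows "\<bar>LINT x|lborel. \<phi> x * ((f (x + h *\<^sub>R a) - f x) / h * ((g (x + h *\<^sub>R b) - g x) / h)
            - (f x - f (x - h *\<^sub>R b)) / h * ((g x - g (x - h *\<^sub>R a)) / h))\<bar>
         \<le> 2 * K * M * e * measure lborel (cball x0 (r + 1))"
proof -
  have e0: "0 \<le> e" using f(2)[of x0] by linarith
  have K0: "0 \<le> K" and M0: "0 \<le> M" using g \<phi> by (auto simp: lipschitz_on_def)
  have cg: "continuous_on UNIV g" and cphi: "continuous_on UNIV \<phi>"
    using g \<phi> by (auto intro: lipschitz_on_continuous_on)
  \<comment> \<open>The vectors \<open>h *\<^sub>R a\<close> and \<open>h *\<^sub>R b\<close> have
    norm at most 1, so enlarging the radius by 1 makes every shifted copy of \<open>\<phi>\<close>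
    vanish off \<open>S\<close>.\<close>
  define S where "S = cball x0 (r + 1)"
  have cS: "compact S" by (simp add: S_def)
  have supp': "\<phi> (x + v) = 0" if "x \<notin> S" "norm v \<le> 1" for x v
  proof (rule supp)
    have "dist x0 x \<le> dist x0 (x + v) + norm v"
      by (metis add_diff_cancel_left' dist_commute dist_norm dist_triangle)
    then show "x + v \<notin> cball x0 r" using that by (auto simp: S_def)
  qed
  have nha: "norm (h *\<^sub>R a) \<le> 1" and nhb: "norm (h *\<^sub>R b) \<le> 1"
    using ab h by (auto intro!: mult_le_one)
  have nhab: "norm (- (h *\<^sub>R a)) \<le> 1" using nha by simp
  note supps = supp'[OF _ nha] supp'[OF _ nhb] supp'[OF _ nhab] supp'[of _ 0]
  have c: "continuous_on UNIV (\<lambda>x. k (p x))"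
    if "continuous_on UNIV k" "continuous_on UNIV p" for k :: "'a \<Rightarrow> real" and p :: "'a \<Rightarrow> 'a"
    using continuous_on_compose2[OF that] by simp
  note cs = c[OF f(1)] c[OF cg] c[OF cphi]
  \<comment> \<open>Multiplied out and sorted by the point at which \<open>f\<close> is evaluated,
    the integrand is \<open>(T1 x - T3 x + T2 x) / h\<^sup>2\<close>. \<open>U1\<close> and
    \<open>U2\<close> are translates of \<open>T1\<close> and \<open>T2\<close> in which
    \<open>f\<close> is evaluated at \<open>x\<close>, so that \<open>f x\<close> becomes a common
    factor.\<close>
  define T1 where "T1 x = \<phi> x * f (x + h *\<^sub>R a) * (g (x + h *\<^sub>R b) - g x)" for x
  define T2 where "T2 x = \<phi> x * f (x - h *\<^sub>R b) * (g x - g (x - h *\<^sub>R a))" for x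
  define T3 where "T3 x = \<phi> x * f x * (g (x + h *\<^sub>R b) - g (x - h *\<^sub>R a))" for x
  define U1 where "U1 x = \<phi> (x - h *\<^sub>R a) * f x * (g (x - h *\<^sub>R a + h *\<^sub>R b) - g (x - h *\<^sub>R a))" for x
  define U2 where "U2 x = \<phi> (x + h *\<^sub>R b) * f x * (g (x + h *\<^sub>R b) - g (x + h *\<^sub>R b - h *\<^sub>R a))" for x
  have cT: "continuous_on UNIV T1" "continuous_on UNIV T2" "continuous_on UNIV T3"
      "continuous_on UNIV U1" "continuous_on UNIV U2"
    unfolding T1_def T2_def T3_def U1_def U2_def
    by (intro continuous_intros cs cg cphi f(1))+
  have iT: "integrable lborel T1" "integrable lborel T2" "integrable lborel T3"
      "integrable lborel U1" "integrable lborel U2"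
    using cT supps
    by (auto intro!: lborel_integrable_compact_support[OF _ cS] simp: T1_def T2_def T3_def U1_def U2_def)
  have mT: "T1 \<in> borel_measurable borel" "T2 \<in> borel_measurable borel"
    using cT by (auto intro: borel_measurable_continuous_onI)
  have "(LINT x|lborel. T1 (x + - (h *\<^sub>R a))) = (LINT x|lborel. T1 x)"
    by (rule lborel_integral_translate[OF mT(1)])
  moreover have "(\<lambda>x. T1 (x + - (h *\<^sub>R a))) = U1"
    by (simp add: T1_def U1_def fun_eq_iff algebra_simps)
  ultimately have t1: "(LINT x|lborel. T1 x) = (LINT x|lborel. U1 x)" by simp
  have "(LINT x|lborel. T2 (x + h *\<^sub>R b)) = (LINT x|lborel. T2 x)"
    by (rule lborel_integral_translate[OF mT(2)])
  moreover have "(\<lambda>x. T2 (x + h *\<^sub>R b)) = U2"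
    by (simp add: T2_def U2_def fun_eq_iff algebra_simps)
  ultimately have t2: "(LINT x|lborel. T2 x) = (LINT x|lborel. U2 x)" by simp
  have "(LINT x|lborel. \<phi> x * ((f (x + h *\<^sub>R a) - f x) / h * ((g (x + h *\<^sub>R b) - g x) / h)
            - (f x - f (x - h *\<^sub>R b)) / h * ((g x - g (x - h *\<^sub>R a)) / h)))
        = (LINT x|lborel. (T1 x - T3 x + T2 x) / h\<^sup>2)"
    using h by (intro Bochner_Integration.integral_cong)
      (auto simp: T1_def T2_def T3_def field_simps power2_eq_square)
  also have "\<dots> = ((LINT x|lborel. T1 x) - (LINT x|lborel. T3 x) + (LINT x|lborel. T2 x)) / h\<^sup>2"
    using iT by simp
  also have "\<dots> = (LINT x|lborel. (U1 x - T3 x + U2 x) / h\<^sup>2)"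
    using iT t1 t2 by simp
  also have "\<bar>\<dots>\<bar> \<le> (LINT x|lborel. indicator S x * (2 * K * M * e))"
  proof (rule integral_abs_bound_integral)
    show "integrable lborel (\<lambda>x. (U1 x - T3 x + U2 x) / h\<^sup>2)" using iT by simp
    show "integrable lborel (\<lambda>x. indicator S x * (2 * K * M * e))"
      using emeasure_lborel_cball_finite[of x0 "r + 1"]
      by (intro integrable_mult_left integrable_real_indicator) (simp_all add: S_def)
    fix x
    show "\<bar>(U1 x - T3 x + U2 x) / h\<^sup>2\<bar> \<le> indicator S x * (2 * K * M * e)"
    proof (cases "x \<in> S")
      case False
      then show ?thesis using supps[OF False] by (simp add: U1_def U2_def T3_def)
    next
      case True
      \<comment> \<open>The corner value \<open>G\<close> occurs in both \<open>U1\<close> and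
        \<open>U2\<close>. Splitting the long difference of \<open>g\<close> in \<open>T3\<close> at
        \<open>G\<close> pairs every one-step difference of \<open>g\<close> with a one-step
        difference of \<open>\<phi>\<close>; each pair is of order \<open>h\<^sup>2\<close>, which
        absorbs the denominator.\<close>
      define G where "G = g (x - h *\<^sub>R a + h *\<^sub>R b)"
      have G': "g (x + h *\<^sub>R b - h *\<^sub>R a) = G" by (simp add: G_def algebra_simps)
      have lg: "\<bar>g y - g z\<bar> \<le> M * norm (y - z)" for y z
        using lipschitz_onD[OF g, of y z] by (simp add: dist_norm)
      have lphi: "\<bar>\<phi> y - \<phi> z\<bar> \<le> K * norm (y - z)" for y z
        using lipschitz_onD[OF \<phi>, of y z] by (simp add: dist_norm)
      have na: "norm (h *\<^sub>R a) \<le> h" "norm (h *\<^sub>R b) \<le> h"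
        using ab h by (simp_all add: mult_left_le)
      have b1: "\<bar>\<phi> (x - h *\<^sub>R a) - \<phi> x\<bar> \<le> K * h"
        using lphi[of "x - h *\<^sub>R a" x] na mult_left_mono[OF na(1) K0] by simp
      have b2: "\<bar>\<phi> (x + h *\<^sub>R b) - \<phi> x\<bar> \<le> K * h"
        using lphi[of "x + h *\<^sub>R b" x] na mult_left_mono[OF na(2) K0] by simp
      have b3: "\<bar>G - g (x - h *\<^sub>R a)\<bar> \<le> M * h"
        using lg[of "x - h *\<^sub>R a + h *\<^sub>R b" "x - h *\<^sub>R a"] mult_left_mono[OF na(2) M0] by (simp add: G_def)
      have b4: "\<bar>g (x + h *\<^sub>R b) - G\<bar> \<le> M * h"
        using lg[of "x + h *\<^sub>R b" "x - h *\<^sub>R a + h *\<^sub>R b"] mult_left_mono[OF na(1) M0] by (simp add: G_def)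
      have "U1 x - T3 x + U2 x = f x * ((\<phi> (x - h *\<^sub>R a) - \<phi> x) * (G - g (x - h *\<^sub>R a))
           + (\<phi> (x + h *\<^sub>R b) - \<phi> x) * (g (x + h *\<^sub>R b) - G))"
        unfolding U1_def U2_def T3_def G' G_def[symmetric] by algebra
      also have "\<bar>\<dots>\<bar> \<le> e * (K * h * (M * h) + K * h * (M * h))"
      proof -
        have "\<bar>(\<phi> (x - h *\<^sub>R a) - \<phi> x) * (G - g (x - h *\<^sub>R a))\<bar> \<le> K * h * (M * h)"
          unfolding abs_mult using b1 b3 K0 h by (intro mult_mono) auto
        moreover have "\<bar>(\<phi> (x + h *\<^sub>R b) - \<phi> x) * (g (x + h *\<^sub>R b) - G)\<bar> \<le> K * h * (M * h)"
          unfolding abs_mult using b2 b4 K0 h by (intro mult_mono) auto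
        ultimately have "\<bar>(\<phi> (x - h *\<^sub>R a) - \<phi> x) * (G - g (x - h *\<^sub>R a))
            + (\<phi> (x + h *\<^sub>R b) - \<phi> x) * (g (x + h *\<^sub>R b) - G)\<bar>
            \<le> K * h * (M * h) + K * h * (M * h)"
          by linarith
        then show ?thesis
          unfolding abs_mult[of "f x"] using f(2)[of x] e0 by (intro mult_mono) auto
      qed
      also have "\<dots> = 2 * K * M * e * h\<^sup>2" by (simp add: power2_eq_square)
      finally show ?thesis using True h by (simp add: field_simps)
    qed
  qed
  also have "\<dots> = 2 * K * M * e * measure lborel S" by (simp add: S_def)
  finally show ?thesis by (simp add: S_def)
qed

text \<open>The discrete bound is uniform in the step size and survives the limit by dominated
  convergence. The constant \<open>Lf\<close> enters only the dominating function, so the integral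
  is small as soon as \<open>f\<close> is uniformly small, however large its gradient.\<close>

lemma jacobian_integral_bound:
  fixes f g \<phi> :: "'a::euclidean_space \<Rightarrow> real" and f' g' :: "'a \<Rightarrow> 'a \<Rightarrow> real"
  assumes f: "Lf-lipschitz_on UNIV f" "\<And>x. \<bar>f x\<bar> \<le> e"
    and g: "M-lipschitz_on UNIV g" and \<phi>: "K-lipschitz_on UNIV \<phi>"
    and supp: "\<And>x. x \<notin> cball x0 r \<Longrightarrow> \<phi> x = 0"
    and ab: "norm a \<le> 1" "norm b \<le> 1"
    and Om: "\<Omega> \<in> sets lebesgue" "\<And>x. x \<notin> \<Omega> \<Longrightarrow> \<phi> x = 0"
    and der: "AE x in lebesgue_on \<Omega>. \<phi> x \<noteq> 0 \<longrightarrow>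
                (f has_derivative f' x) (at x) \<and> (g has_derivative g' x) (at x)"
    and meas: "(\<lambda>x. \<phi> x * (f' x a * g' x b - f' x b * g' x a)) \<in> borel_measurable (lebesgue_on \<Omega>)"
  shows "\<bar>LINT x|lebesgue_on \<Omega>. \<phi> x * (f' x a * g' x b - f' x b * g' x a)\<bar>
         \<le> 2 * K * M * e * measure lborel (cball x0 (r + 1))"
proof -
  define h where "h n = 1 / real (Suc n)" for n
  have h: "h n > 0" "h n \<le> 1" "h n \<noteq> 0" for n by (auto simp: h_def)
  have h0: "h \<longlonglongrightarrow> 0" unfolding h_def by (rule LIMSEQ_Suc[OF lim_1_over_n])
  define s where "s n x = \<phi> x * ((f (x + h n *\<^sub>R a) - f x) / h n * ((g (x + h n *\<^sub>R b) - g x) / h n)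
            - (f x - f (x - h n *\<^sub>R b)) / h n * ((g x - g (x - h n *\<^sub>R a)) / h n))" for n x
  have cf: "continuous_on UNIV f" and cg: "continuous_on UNIV g" and cphi: "continuous_on UNIV \<phi>"
    using f g \<phi> by (auto intro: lipschitz_on_continuous_on)
  have c: "continuous_on UNIV (\<lambda>x. k (p x))"
    if "continuous_on UNIV k" "continuous_on UNIV p" for k :: "'a \<Rightarrow> real" and p :: "'a \<Rightarrow> 'a"
    using continuous_on_compose2[OF that] by simp
  have "continuous_on UNIV (s n)" for n
    unfolding s_def using h(3)[of n]
    by (intro continuous_intros c[OF cf] c[OF cg] c[OF cphi] cf cg cphi) auto
  then have ms: "s n \<in> borel_measurable borel" for n
    by (auto intro: borel_measurable_continuous_onI)
  have K0: "0 \<le> K" and M0: "0 \<le> M" and L0: "0 \<le> Lf" using f g \<phi> by (auto simp: lipschitz_on_def)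
  have cphi': "continuous_on UNIV (\<lambda>x. \<bar>\<phi> x\<bar> * (2 * Lf * M))"
    by (intro continuous_intros cphi)
  have "integrable lborel (\<lambda>x. \<bar>\<phi> x\<bar> * (2 * Lf * M))"
    by (rule lborel_integrable_compact_support[OF cphi', of "cball x0 r"]) (auto simp: supp)
  then have "integrable lebesgue (\<lambda>x. \<bar>\<phi> x\<bar> * (2 * Lf * M))"
    by (subst integrable_completion) auto
  then have dom: "integrable (lebesgue_on \<Omega>) (\<lambda>x. \<bar>\<phi> x\<bar> * (2 * Lf * M))"
    using integrable_mult_indicator[OF Om(1)] Om(1) by (subst integrable_restrict_space) blast+
  have bound: "norm (s n x) \<le> \<bar>\<phi> x\<bar> * (2 * Lf * M)" for n x
  proof -
    have lq: "\<bar>(k y - k z) / h n\<bar> \<le> C" if k: "C-lipschitz_on UNIV k" and "norm (y - z) \<le> h n"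
      for k :: "'a \<Rightarrow> real" and C y z
    proof -
      have "\<bar>k y - k z\<bar> \<le> C * norm (y - z)"
        using lipschitz_onD[OF k, of y z] by (simp add: dist_norm)
      also have "\<dots> \<le> C * h n"
        using that by (intro mult_left_mono) (auto simp: lipschitz_on_def)
      finally show ?thesis using h(1)[of n] by (simp add: field_simps)
    qed
    have na: "norm (h n *\<^sub>R a) \<le> h n" "norm (h n *\<^sub>R b) \<le> h n"
      using ab h(1)[of n] by (simp_all add: mult_left_le)
    have "\<bar>(f (x + h n *\<^sub>R a) - f x) / h n * ((g (x + h n *\<^sub>R b) - g x) / h n)\<bar> \<le> Lf * M"
      unfolding abs_mult using na L0 by (intro mult_mono lq[OF f(1)] lq[OF g]) auto
    moreover have "\<bar>(f x - f (x - h n *\<^sub>R b)) / h n * ((g x - g (x - h n *\<^sub>R a)) / h n)\<bar> \<le> Lf * M"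
      unfolding abs_mult using na L0 by (intro mult_mono lq[OF f(1)] lq[OF g]) auto
    ultimately have "\<bar>(f (x + h n *\<^sub>R a) - f x) / h n * ((g (x + h n *\<^sub>R b) - g x) / h n)
        - (f x - f (x - h n *\<^sub>R b)) / h n * ((g x - g (x - h n *\<^sub>R a)) / h n)\<bar> \<le> 2 * Lf * M"
      by linarith
    then show ?thesis
      unfolding s_def real_norm_def abs_mult[of "\<phi> x"] by (intro mult_left_mono) auto
  qed
  have lim: "AE x in lebesgue_on \<Omega>. (\<lambda>n. s n x) \<longlonglongrightarrow> \<phi> x * (f' x a * g' x b - f' x b * g' x a)"
    using der
  proof eventually_elim
    case (elim x)
    show ?case
    proof (cases "\<phi> x = 0")
      case True
      then show ?thesis by (simp add: s_def)
    next
      case False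
      then have df: "(f has_derivative f' x) (at x)" and dg: "(g has_derivative g' x) (at x)"
        using elim by auto
      \<comment> \<open>A backward quotient with step \<open>h n\<close> is a forward quotient with
        step \<open>- h n\<close>.\<close>
      have h0': "(\<lambda>n. - h n) \<longlonglongrightarrow> 0" using tendsto_minus[OF h0] by simp
      have *: "(k (x + - h n *\<^sub>R v) - k x) / - h n = (k x - k (x - h n *\<^sub>R v)) / h n"
        for n v and k :: "'a \<Rightarrow> real"
        using h(3)[of n] by (simp add: field_simps)
      note q = has_derivative_quotient_LIMSEQ[OF _ h0 h(3)]
      have q': "(\<lambda>n. (k x - k (x - h n *\<^sub>R v)) / h n) \<longlonglongrightarrow> k' v"
        if "(k has_derivative k') (at x)" for k k' v
        using has_derivative_quotient_LIMSEQ[OF that h0', of v] h(3) unfolding * by auto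
      show ?thesis unfolding s_def
        by (intro tendsto_mult tendsto_diff tendsto_const q[OF df] q[OF dg] q'[OF df] q'[OF dg])
    qed
  qed
  have "(\<lambda>n. LINT x|lebesgue_on \<Omega>. s n x)
      \<longlonglongrightarrow> (LINT x|lebesgue_on \<Omega>. \<phi> x * (f' x a * g' x b - f' x b * g' x a))"
    using ms by (intro integral_dominated_convergence[OF meas _ dom lim])
      (auto intro!: measurable_restrict_space1 measurable_completion bound[unfolded real_norm_def] AE_I2)
  then have "(\<lambda>n. \<bar>LINT x|lebesgue_on \<Omega>. s n x\<bar>)
      \<longlonglongrightarrow> \<bar>LINT x|lebesgue_on \<Omega>. \<phi> x * (f' x a * g' x b - f' x b * g' x a)\<bar>"
    by (rule tendsto_rabs)
  moreover have "\<bar>LINT x|lebesgue_on \<Omega>. s n x\<bar> \<le> 2 * K * M * e * measure lborel (cball x0 (r + 1))" for n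
  proof -
    have "(LINT x|lebesgue_on \<Omega>. s n x) = (LINT x|lborel. s n x)"
      using Om by (intro lebesgue_on_integral_eq_lborel ms) (auto simp: s_def)
    then show ?thesis
      using discrete_jacobian_bound[OF cf f(2) g \<phi> supp ab h(1)[of n] h(2)[of n]] by (simp add: s_def)
  qed
  ultimately show ?thesis by (intro LIMSEQ_le_const2) auto
qed

section \<open>Gradients of Lipschitz maps\<close>

lemma lipschitz_has_derivative_bound:
  fixes f :: "'a::real_normed_vector \<Rightarrow> real"
  assumes f: "L-lipschitz_on \<Omega> f" and x: "open \<Omega>" "x \<in> \<Omega>"
    and der: "(f has_derivative f') (at x)"
  shows "\<bar>f' a\<bar> \<le> L * norm a"
proof -
  define h where "h n = 1 / real (Suc n)" for n
  have h: "h n > 0" "h n \<noteq> 0" for n by (auto simp: h_def)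
  have h0: "h \<longlonglongrightarrow> 0" unfolding h_def by (rule LIMSEQ_Suc[OF lim_1_over_n])
  have "(\<lambda>n. x + h n *\<^sub>R a) \<longlonglongrightarrow> x + 0 *\<^sub>R a" by (intro tendsto_intros h0)
  then have ev: "\<forall>\<^sub>F n in sequentially. x + h n *\<^sub>R a \<in> \<Omega>"
    using topological_tendstoD x by fastforce
  have "\<forall>\<^sub>F n in sequentially. \<bar>(f (x + h n *\<^sub>R a) - f x) / h n\<bar> \<le> L * norm a"
    using ev
  proof eventually_elim
    case (elim n)
    then have "\<bar>f (x + h n *\<^sub>R a) - f x\<bar> \<le> L * (h n * norm a)"
      using lipschitz_onD[OF f elim x(2)] h(1)[of n] by (simp add: dist_norm)
    then show ?case using h(1)[of n] by (simp add: field_simps)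
  qed
  moreover have "(\<lambda>n. \<bar>(f (x + h n *\<^sub>R a) - f x) / h n\<bar>) \<longlonglongrightarrow> \<bar>f' a\<bar>"
    by (intro tendsto_rabs has_derivative_quotient_LIMSEQ[OF der h0 h(2)])
  ultimately show ?thesis using tendsto_upperbound trivial_limit_sequentially by blast
qed

lemma matrix_vector_mult_axis_nth: "(A *v axis a 1) $ i = (A :: real^'m^'n) $ i $ a"
  by (simp add: matrix_vector_mult_basis column_def)

lemma gradient_component:
  fixes G :: "real^'m \<Rightarrow> real^'m^'n"
  assumes "(u has_derivative (\<lambda>h. G x *v h)) (at x)"
  shows "((\<lambda>x. u x $ i) has_derivative (\<lambda>h. (G x *v h) $ i)) (at x)"
  using bounded_linear.has_derivative[OF bounded_linear_vec_nth assms] .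

text \<open>Each entry of the gradient is the derivative of a component of \<open>u\<close> along a
  unit coordinate vector, and components inherit the Lipschitz constant.\<close>

lemma gradient_entry_bound:
  fixes u :: "real^'m \<Rightarrow> real^'n"
  assumes u: "L-lipschitz_on \<Omega> u" and Om: "open \<Omega>" and G: "is_gradient_on \<Omega> u G"
  shows "AE x in lebesgue_on \<Omega>. \<bar>G x $ i $ a\<bar> \<le> L"
proof -
  have "AE x in lebesgue_on \<Omega>. x \<in> \<Omega>" by (rule AE_I2) simp
  then show ?thesis using G unfolding is_gradient_on_def
  proof eventually_elim
    case (elim x)
    have "L-lipschitz_on \<Omega> (\<lambda>x. u x $ i)"
    proof (rule lipschitz_onI)
      show "dist (u y $ i) (u z $ i) \<le> L * dist y z" if "y \<in> \<Omega>" "z \<in> \<Omega>" for y z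
        using lipschitz_onD[OF u that] dist_vec_nth_le order_trans by blast
    qed (use u in \<open>auto simp: lipschitz_on_def\<close>)
    from lipschitz_has_derivative_bound[OF this Om elim(1) gradient_component[where G=G, OF elim(2)], of "axis a 1"]
    show ?case by (simp add: matrix_vector_mult_axis_nth)
  qed
qed

section \<open>Boundedness and integrability for gradient Young measures\<close>

lemma homogeneous_gradient_young_measureE:
  fixes \<nu> :: "(real^'m^'n) measure"
  assumes "homogeneous_gradient_young_measure \<nu>"
  obtains \<Omega> :: "(real^'m) set" and u Du L C
  where "prob_space \<nu>" "sets \<nu> = sets borel" "open \<Omega>" "bounded \<Omega>" "convex \<Omega>" "\<Omega> \<noteq> {}"
    "\<And>j. L-lipschitz_on \<Omega> (u j)" "\<And>j x. x \<in> \<Omega> \<Longrightarrow> norm (u j x) \<le> C"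
    "\<And>j. is_gradient_on \<Omega> (u j) (Du j)"
    "\<And>(F :: real^'m^'n \<Rightarrow> real) j. continuous_on UNIV F \<Longrightarrow> (\<lambda>x. F (Du j x)) \<in> borel_measurable (lebesgue_on \<Omega>)"
    "\<And>(F :: real^'m^'n \<Rightarrow> real) \<phi>. continuous_on UNIV F \<Longrightarrow> integrable (lebesgue_on \<Omega>) \<phi> \<Longrightarrow>
        (\<lambda>j. LINT x|lebesgue_on \<Omega>. F (Du j x) * \<phi> x)
          \<longlonglongrightarrow> (LINT A|\<nu>. F A) * (LINT x|lebesgue_on \<Omega>. \<phi> x)"
proof -
  from assms obtain \<Omega> :: "(real^'m) set" and u :: "nat \<Rightarrow> real^'m \<Rightarrow> real^'n" and Du
    where ps: "prob_space \<nu>" and sets: "sets \<nu> = sets borel"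
      and Om: "open \<Omega>" "bounded \<Omega>" "convex \<Omega>" "\<Omega> \<noteq> {}"
      and u: "\<exists>L. \<forall>j. L-lipschitz_on \<Omega> (u j)" "\<exists>C. \<forall>j. \<forall>x\<in>\<Omega>. norm (u j x) \<le> C"
      and Du: "\<forall>j. is_gradient_on \<Omega> (u j) (Du j)"
      and w: "\<And>F :: real^'m^'n \<Rightarrow> real. continuous_on UNIV F \<Longrightarrow>
           weak_star_Linfty \<Omega> (\<lambda>j x. F (Du j x)) (\<lambda>x. LINT A|\<nu>. F A)"
    unfolding homogeneous_gradient_young_measure_def by metis
  from u obtain L C where u': "\<And>j. L-lipschitz_on \<Omega> (u j)" "\<And>j x. x \<in> \<Omega> \<Longrightarrow> norm (u j x) \<le> C"
    by blast
  have m: "(\<lambda>x. F (Du j x)) \<in> borel_measurable (lebesgue_on \<Omega>)"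
    if "continuous_on UNIV F" for F :: "real^'m^'n \<Rightarrow> real" and j
    using w[OF that] unfolding weak_star_Linfty_def in_Linfty_def by blast
  have l: "(\<lambda>j. LINT x|lebesgue_on \<Omega>. F (Du j x) * \<phi> x)
      \<longlonglongrightarrow> (LINT A|\<nu>. F A) * (LINT x|lebesgue_on \<Omega>. \<phi> x)"
    if "continuous_on UNIV F" "integrable (lebesgue_on \<Omega>) \<phi>" for F :: "real^'m^'n \<Rightarrow> real" and \<phi>
    using w[OF that(1)] that(2) unfolding weak_star_Linfty_def by simp
  show ?thesis by (rule that[OF ps sets Om u' Du[rule_format] m l])
qed

lemma lebesgue_on_open_finite:
  fixes \<Omega> :: "'a::euclidean_space set"
  assumes "open \<Omega>" "bounded \<Omega>"
  shows "finite_measure (lebesgue_on \<Omega>)" "\<Omega> \<noteq> {} \<Longrightarrow> measure (lebesgue_on \<Omega>) \<Omega> > 0"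
proof -
  have fm: "\<Omega> \<in> lmeasurable" using assms by (simp add: lmeasurable_open)
  then show "finite_measure (lebesgue_on \<Omega>)" by (rule finite_measure_lebesgue_on)
  show "measure (lebesgue_on \<Omega>) \<Omega> > 0" if "\<Omega> \<noteq> {}"
  proof -
    have "measure lebesgue \<Omega> \<noteq> 0"
      using open_not_negligible[OF assms(1) that] fm by (auto simp: negligible_iff_measure0)
    moreover have "measure (lebesgue_on \<Omega>) \<Omega> = measure lebesgue \<Omega>"
      using assms by (subst measure_restrict_space) auto
    ultimately show ?thesis by (simp add: zero_less_measure_iff)
  qed
qed

text \<open>The excess of an entry over the common Lipschitz constant \<open>L\<close>, truncated at
  1, is continuous and bounded, hence integrable before any moment of \<open>\<nu>\<close> is known
  to be finite. It vanishes along the gradients, so testing with the constant 1 shows that its mean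
  under \<open>\<nu>\<close> is zero.\<close>

lemma homogeneous_gradient_young_measure_bounded:
  fixes \<nu> :: "(real^'m^'n) measure"
  assumes "homogeneous_gradient_young_measure \<nu>"
  obtains R where "AE A in \<nu>. norm A \<le> R"
proof -
  obtain \<Omega> :: "(real^'m) set" and u Du L C
  where ps: "prob_space \<nu>" and sets: "sets \<nu> = sets borel"
    and Om: "open \<Omega>" "bounded \<Omega>" "convex \<Omega>" "\<Omega> \<noteq> {}"
    and u: "\<And>j. L-lipschitz_on \<Omega> (u j)" "\<And>j x. x \<in> \<Omega> \<Longrightarrow> norm (u j x) \<le> C"
    and Du: "\<And>j. is_gradient_on \<Omega> (u j) (Du j)"
    and m: "\<And>(F :: real^'m^'n \<Rightarrow> real) j. continuous_on UNIV F \<Longrightarrow> (\<lambda>x. F (Du j x)) \<in> borel_measurable (lebesgue_on \<Omega>)"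
    and w: "\<And>(F :: real^'m^'n \<Rightarrow> real) \<phi>. continuous_on UNIV F \<Longrightarrow> integrable (lebesgue_on \<Omega>) \<phi> \<Longrightarrow>
        (\<lambda>j. LINT x|lebesgue_on \<Omega>. F (Du j x) * \<phi> x)
          \<longlonglongrightarrow> (LINT A|\<nu>. F A) * (LINT x|lebesgue_on \<Omega>. \<phi> x)"
    by (rule homogeneous_gradient_young_measureE[OF assms], rule that; assumption)
  interpret prob_space \<nu> by (rule ps)
  interpret Om: finite_measure "lebesgue_on \<Omega>" using lebesgue_on_open_finite Om by blast
  have "AE A in \<nu>. \<bar>A $ i $ a\<bar> \<le> L" for i a
  proof -
    define F where "F A = min 1 (max 0 (\<bar>A $ i $ a\<bar> - L))" for A :: "real^'m^'n"
    have cF: "continuous_on UNIV F" unfolding F_def by (intro continuous_intros)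
    then have mF: "F \<in> borel_measurable \<nu>"
      using sets by (metis borel_measurable_continuous_onI measurable_cong_sets)
    have iF: "integrable \<nu> F"
      by (rule integrable_const_bound[of _ 1]) (use mF in \<open>auto simp: F_def\<close>)
    have "(LINT x|lebesgue_on \<Omega>. F (Du j x) * 1) = 0" for j
    proof (rule integral_eq_zero_AE)
      show "AE x in lebesgue_on \<Omega>. F (Du j x) * 1 = 0"
        using gradient_entry_bound[OF u(1) Om(1) Du, of j i a]
        by eventually_elim (simp add: F_def)
    qed
    with w[OF cF, of "\<lambda>_. 1"] have "(LINT A|\<nu>. F A) * measure (lebesgue_on \<Omega>) \<Omega> = 0"
      by (simp add: LIMSEQ_const_iff)
    then have "(LINT A|\<nu>. F A) = 0"
      using lebesgue_on_open_finite(2)[OF Om(1,2,4)] by simp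
    moreover have "AE A in \<nu>. 0 \<le> F A" by (simp add: F_def)
    ultimately have "AE A in \<nu>. F A = 0"
      using integral_nonneg_eq_0_iff_AE[OF iF] by blast
    then show ?thesis by eventually_elim (auto simp: F_def min_def max_def split: if_splits)
  qed
  then have "AE A in \<nu>. \<forall>i a. \<bar>A $ i $ a\<bar> \<le> L"
    by (subst AE_all_countable[symmetric] | simp add: AE_all_countable)+
  then have "AE A in \<nu>. norm A \<le> (\<Sum>i\<in>(UNIV::'n set). \<Sum>a\<in>(UNIV::'m set). L)"
  proof eventually_elim
    case (elim A)
    have "norm A \<le> (\<Sum>i\<in>UNIV. norm (A $ i))" unfolding norm_vec_def by (rule L2_set_le_sum) simp
    also have "\<dots> \<le> (\<Sum>i\<in>UNIV. \<Sum>a\<in>UNIV. \<bar>A $ i $ a\<bar>)" by (intro sum_mono norm_le_l1_cart)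
    also have "\<dots> \<le> (\<Sum>i\<in>(UNIV::'n set). \<Sum>a\<in>(UNIV::'m set). L)"
      using elim by (intro sum_mono) auto
    finally show ?case .
  qed
  then show ?thesis by (rule that)
qed

text \<open>A continuous function is bounded on the ball that carries \<open>\<nu>\<close>. Since
  the Bochner integral of a nonintegrable function is 0 by convention, this fact is what gives the
  barycenter and the moments below their intended meaning.\<close>

lemma homogeneous_gradient_young_measure_integrable:
  fixes \<nu> :: "(real^'m^'n) measure" and F :: "real^'m^'n \<Rightarrow> 'b::{banach, second_countable_topology}"
  assumes \<nu>: "homogeneous_gradient_young_measure \<nu>" and F: "continuous_on UNIV F"
  shows "integrable \<nu> F"
proof -
  interpret prob_space \<nu> using \<nu> by (simp add: homogeneous_gradient_young_measure_def)
  have sets: "sets \<nu> = sets borel" using \<nu> by (simp add: homogeneous_gradient_young_measure_def)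
  obtain R where R: "AE A in \<nu>. norm A \<le> R"
    using homogeneous_gradient_young_measure_bounded[OF \<nu>] .
  have "compact (F ` cball 0 R)"
    using F by (intro compact_continuous_image) (auto intro: continuous_on_subset)
  then obtain B where B: "\<And>A. A \<in> cball 0 R \<Longrightarrow> norm (F A) \<le> B"
    using compact_imp_bounded bounded_iff by (metis imageI)
  show ?thesis
  proof (rule integrable_const_bound)
    show "AE A in \<nu>. norm (F A) \<le> B" using R by eventually_elim (auto intro: B)
    show "F \<in> borel_measurable \<nu>"
      using F sets by (metis borel_measurable_continuous_onI measurable_cong_sets)
  qed
qed

section \<open>Weak continuity of minors\<close>

text \<open>
  By compactness and the Jacobian bound, \<open>\<integral> \<phi> Du\<^sub>m\<^sup>i \<and> Du\<^sub>n\<^sup>k\<close> and \<open>\<integral> \<phi> Du\<^sub>n\<^sup>i \<and> Du\<^sub>n\<^sup>k\<close> are close for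
  large \<open>m, n\<close> of a subsequence.  Letting first \<open>n\<close> and then \<open>m\<close> tend to infinity, only products of
  a weak-* convergent sequence with a fixed function have to be passed to the limit.
\<close>

lemma homogeneous_gradient_young_measure_minor:
  fixes \<nu> :: "(real^'m^'n) measure"
  assumes \<nu>: "homogeneous_gradient_young_measure \<nu>"
  shows "(LINT A|\<nu>. A $ i $ a * A $ k $ b - A $ i $ b * A $ k $ a)
       = (LINT A|\<nu>. A $ i $ a) * (LINT A|\<nu>. A $ k $ b) - (LINT A|\<nu>. A $ i $ b) * (LINT A|\<nu>. A $ k $ a)"
    (is "?lhs = ?rhs")
proof -
  obtain \<Omega> :: "(real^'m) set" and u Du L C
  where ps: "prob_space \<nu>" and sets: "sets \<nu> = sets borel"
    and Om: "open \<Omega>" "bounded \<Omega>" "convex \<Omega>" "\<Omega> \<noteq> {}"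
    and u: "\<And>j. L-lipschitz_on \<Omega> (u j)" "\<And>j x. x \<in> \<Omega> \<Longrightarrow> norm (u j x) \<le> C"
    and Du: "\<And>j. is_gradient_on \<Omega> (u j) (Du j)"
    and m: "\<And>(F :: real^'m^'n \<Rightarrow> real) j. continuous_on UNIV F \<Longrightarrow> (\<lambda>x. F (Du j x)) \<in> borel_measurable (lebesgue_on \<Omega>)"
    and w: "\<And>(F :: real^'m^'n \<Rightarrow> real) \<phi>. continuous_on UNIV F \<Longrightarrow> integrable (lebesgue_on \<Omega>) \<phi> \<Longrightarrow>
        (\<lambda>j. LINT x|lebesgue_on \<Omega>. F (Du j x) * \<phi> x)
          \<longlonglongrightarrow> (LINT A|\<nu>. F A) * (LINT x|lebesgue_on \<Omega>. \<phi> x)"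
    by (rule homogeneous_gradient_young_measureE[OF \<nu>], rule that; assumption)
  interpret Om: finite_measure "lebesgue_on \<Omega>" using lebesgue_on_open_finite Om by blast
  have L0: "0 \<le> L" using u(1) by (auto simp: lipschitz_on_def)
  have OmS: "\<Omega> \<in> sets lebesgue" using Om by auto
  obtain x0 where "x0 \<in> \<Omega>" using Om by auto
  then obtain r where r: "r > 0" "cball x0 r \<subseteq> \<Omega>" using Om(1) open_contains_cball by blast
  define Q where "Q = cball x0 r"
  have Q: "convex Q" "closed Q" "Q \<noteq> {}" "compact Q" "Q \<subseteq> \<Omega>" using r by (auto simp: Q_def)
  \<comment> \<open>The nearest-point projection onto the ball \<open>Q\<close> is 1-Lipschitz, so
    composing with it extends \<open>u j\<close> from \<open>Q\<close> to the whole space with the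
    same constant \<open>L\<close>, as the Jacobian bound requires.\<close>
  define P where "P = closest_point Q"
  have PQ: "P x \<in> Q" for x using Q by (auto simp: P_def closest_point_in_set)
  have Plip: "dist (P x) (P y) \<le> dist x y" for x y
    unfolding P_def by (rule closest_point_lipschitz) (use Q in auto)
  have Pid: "P x = x" if "x \<in> Q" for x using that by (simp add: P_def closest_point_self)
  define f where "f j x = u j (P x) $ i" for j x
  define g where "g j x = u j (P x) $ k" for j x
  \<comment> \<open>A cone-shaped cutoff: 1-Lipschitz, supported in the ball where \<open>P\<close>
    is the identity, and of positive integral.\<close>
  define \<phi> where "\<phi> x = max 0 (r - dist x0 x)" for x
  have lipc: "L-lipschitz_on UNIV (\<lambda>x. u j (P x) $ l)" for j l
  proof (rule lipschitz_onI[OF _ L0])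
    fix x y
    have "dist (u j (P x) $ l) (u j (P y) $ l) \<le> dist (u j (P x)) (u j (P y))" by (rule dist_vec_nth_le)
    also have "\<dots> \<le> L * dist (P x) (P y)" using Q PQ by (intro lipschitz_onD[OF u(1)]) auto
    also have "\<dots> \<le> L * dist x y" by (intro mult_left_mono Plip L0)
    finally show "dist (u j (P x) $ l) (u j (P y) $ l) \<le> L * dist x y" .
  qed
  have philip: "1-lipschitz_on UNIV \<phi>"
  proof (rule lipschitz_onI)
    fix x y
    have "\<bar>dist x0 x - dist x0 y\<bar> \<le> dist x y" by (metis abs_dist_diff_le dist_commute)
    then show "dist (\<phi> x) (\<phi> y) \<le> 1 * dist x y" by (auto simp: \<phi>_def dist_real_def)
  qed simp
  have supp: "\<phi> x = 0" if "x \<notin> cball x0 r" for x using that by (auto simp: \<phi>_def)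
  have suppO: "\<phi> x = 0" if "x \<notin> \<Omega>" for x using that r(2) supp by blast
  have phib: "0 \<le> \<phi> x" "\<phi> x \<le> r" for x using r by (auto simp: \<phi>_def)
  have cphi: "continuous_on UNIV \<phi>" using philip by (rule lipschitz_on_continuous_on)
  have mphi: "\<phi> \<in> borel_measurable (lebesgue_on \<Omega>)"
    using cphi by (auto intro!: measurable_restrict_space1 measurable_completion borel_measurable_continuous_onI)
  have iphi: "integrable (lebesgue_on \<Omega>) \<phi>"
    by (rule Om.integrable_const_bound[of _ r]) (use phib mphi in auto)
  define T where "T = (LINT x|lebesgue_on \<Omega>. \<phi> x)"
  \<comment> \<open>\<open>T\<close> is cancelled at the very end. It is positive because
    \<open>\<phi>\<close> is at least \<open>r/2\<close> on the concentric ball of half the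
    radius.\<close>
  have Tpos: "T > 0"
  proof -
    have i1: "integrable lborel \<phi>"
      by (rule lborel_integrable_compact_support[OF cphi, of "cball x0 r"]) (auto simp: supp)
    have "T = (LINT x|lborel. \<phi> x)" unfolding T_def
      using OmS suppO cphi by (intro lebesgue_on_integral_eq_lborel) (auto intro: borel_measurable_continuous_onI)
    also have "\<dots> \<ge> (LINT x|lborel. indicator (cball x0 (r/2)) x * (r/2))"
    proof (rule integral_mono[OF _ i1])
      show "integrable lborel (\<lambda>x. indicator (cball x0 (r/2)) x * (r/2))"
        using emeasure_lborel_cball_finite[of x0 "r/2"]
        by (intro integrable_mult_left integrable_real_indicator) simp_all
      show "indicator (cball x0 (r/2)) x * (r/2) \<le> \<phi> x" for x
        by (auto simp: \<phi>_def indicator_def max_def)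
    qed
    finally have "T \<ge> measure lborel (cball x0 (r/2)) * (r/2)" by simp
    moreover have "measure lborel (cball x0 (r/2)) > 0"
      using content_cball_pos[of "r/2" x0] r by simp
    ultimately show ?thesis using r(1) by (smt (verit) half_gt_zero mult_pos_pos)
  qed
  have cont: "continuous_on UNIV (\<lambda>A::real^'m^'n. A $ l $ c)" for l c by (intro continuous_intros)
  have bnd: "AE x in lebesgue_on \<Omega>. \<bar>Du j x $ l $ c\<bar> \<le> L" for j l c
    by (rule gradient_entry_bound[OF u(1) Om(1) Du])
  have mes: "(\<lambda>x. Du j x $ l $ c) \<in> borel_measurable (lebesgue_on \<Omega>)" for j l c
    by (rule m[OF cont])
  have iD: "integrable (lebesgue_on \<Omega>) (\<lambda>x. \<phi> x * Du j x $ l $ c)" for j l c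
  proof (rule Om.integrable_const_bound)
    show "AE x in lebesgue_on \<Omega>. norm (\<phi> x * Du j x $ l $ c) \<le> r * L"
      using bnd[of j l c] by eventually_elim (use phib r in \<open>auto simp: abs_mult intro!: mult_mono\<close>)
  qed (use mphi mes in measurable)
  have iDD: "integrable (lebesgue_on \<Omega>) (\<lambda>x. Du j' x $ l' $ c' * (\<phi> x * Du j x $ l $ c))" for j l c j' l' c'
  proof (rule Om.integrable_const_bound)
    show "AE x in lebesgue_on \<Omega>. norm (Du j' x $ l' $ c' * (\<phi> x * Du j x $ l $ c)) \<le> L * (r * L)"
      using bnd[of j l c] bnd[of j' l' c']
      by eventually_elim (use phib r in \<open>auto simp: abs_mult intro!: mult_mono\<close>)
  qed (use mphi mes in measurable)
  define E where "E l c = (LINT A|\<nu>. A $ l $ c)" for l c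
  \<comment> \<open>The weighted Jacobian of component \<open>i\<close> of \<open>u p\<close>
    against component \<open>k\<close> of \<open>u n\<close>. The factors are grouped so that, for
    fixed \<open>p\<close>, each term is an entry of \<open>Du n\<close> times a fixed integrable
    test function; \<open>V p\<close> is then the limit in \<open>n\<close>.\<close>
  define jac where "jac p n x = Du n x $ k $ b * (\<phi> x * Du p x $ i $ a) - Du n x $ k $ a * (\<phi> x * Du p x $ i $ b)" for p n x
  define V where "V p = E k b * (LINT x|lebesgue_on \<Omega>. \<phi> x * Du p x $ i $ a) - E k a * (LINT x|lebesgue_on \<Omega>. \<phi> x * Du p x $ i $ b)" for p
  have lim1: "(\<lambda>n. LINT x|lebesgue_on \<Omega>. jac p n x) \<longlonglongrightarrow> V p" for p
    unfolding jac_def V_def E_def Bochner_Integration.integral_diff[OF iDD iDD]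
    by (intro tendsto_diff w cont iD)
  have lim2: "V \<longlonglongrightarrow> ?rhs * T"
  proof -
    have *: "(\<lambda>p. LINT x|lebesgue_on \<Omega>. \<phi> x * Du p x $ i $ c) \<longlonglongrightarrow> E i c * T" for c
      using w[OF cont iphi, of i c] by (simp add: E_def T_def mult.commute)
    have "V \<longlonglongrightarrow> E k b * (E i a * T) - E k a * (E i b * T)"
      unfolding V_def[abs_def] by (intro tendsto_intros *)
    then show ?thesis by (simp add: E_def algebra_simps)
  qed
  \<comment> \<open>On the diagonal the integrand is a continuous function of the single gradient
    \<open>Du n\<close>, so the Young measure gives the limit of the minor directly.\<close>
  have lim3: "(\<lambda>n. LINT x|lebesgue_on \<Omega>. jac n n x) \<longlonglongrightarrow> ?lhs * T"
  proof -
    have "continuous_on UNIV (\<lambda>A::real^'m^'n. A $ i $ a * A $ k $ b - A $ i $ b * A $ k $ a)"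
      by (intro continuous_intros)
    from w[OF this iphi] show ?thesis by (simp add: jac_def T_def algebra_simps)
  qed
  define R where "R = 2 * L * measure lborel (cball x0 (r + 1))"
  have R0: "0 \<le> R" using L0 by (simp add: R_def)
  \<comment> \<open>The difference of the two integrals is the Jacobian integral of
    \<open>f p - f n\<close> against \<open>g n\<close>, and the first function is bounded by
    \<open>e\<close>.\<close>
  have close: "\<bar>(LINT x|lebesgue_on \<Omega>. jac p n x) - (LINT x|lebesgue_on \<Omega>. jac n n x)\<bar> \<le> e * R"
    if e: "\<And>x. x \<in> Q \<Longrightarrow> \<bar>u p x $ i - u n x $ i\<bar> \<le> e" for p n e
  proof -
    have ijac: "integrable (lebesgue_on \<Omega>) (jac p n)" for p n
      unfolding jac_def[abs_def] by (intro Bochner_Integration.integrable_diff iDD)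
    have lf: "(L + L)-lipschitz_on UNIV (\<lambda>x. f p x - f n x)"
      unfolding f_def by (intro lipschitz_on_diff lipc)
    have ef: "\<bar>f p x - f n x\<bar> \<le> e" for x unfolding f_def by (rule e[OF PQ])
    have lg: "L-lipschitz_on UNIV (g n)" unfolding g_def[abs_def] by (rule lipc)
    define f' where "f' x v = (Du p x *v v) $ i - (Du n x *v v) $ i" for x v
    define g' where "g' x v = (Du n x *v v) $ k" for x v
    have rw: "\<phi> x * (f' x (axis a 1) * g' x (axis b 1) - f' x (axis b 1) * g' x (axis a 1))
        = jac p n x - jac n n x" for x
      by (simp add: f'_def g'_def jac_def matrix_vector_mult_axis_nth algebra_simps)
    have der: "AE x in lebesgue_on \<Omega>. \<phi> x \<noteq> 0 \<longrightarrow>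
        ((\<lambda>x. f p x - f n x) has_derivative f' x) (at x) \<and> (g n has_derivative g' x) (at x)"
      using Du[of p, unfolded is_gradient_on_def] Du[of n, unfolded is_gradient_on_def]
    proof eventually_elim
      case (elim x)
      show ?case
      proof
        assume "\<phi> x \<noteq> 0"
        \<comment> \<open>Where \<open>\<phi>\<close> is nonzero, \<open>x\<close> is interior to
          \<open>Q\<close>. There \<open>P\<close> is the identity near \<open>x\<close>, so the
          extension has the same derivative as \<open>u j\<close>.\<close>
        then have x: "x \<in> ball x0 r" by (auto simp: \<phi>_def split: if_splits)
        have tr: "((\<lambda>x. u j (P x) $ l) has_derivative (\<lambda>v. (Du j x *v v) $ l)) (at x)"
          if "(u j has_derivative (\<lambda>h. Du j x *v h)) (at x)" for j l
          by (rule has_derivative_transform_within_open[OF gradient_component[where G="Du j", OF that] open_ball x])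
            (use Pid in \<open>auto simp: Q_def\<close>)
        show "((\<lambda>x. f p x - f n x) has_derivative f' x) (at x) \<and> (g n has_derivative g' x) (at x)"
          unfolding f_def g_def f'_def g'_def
          using has_derivative_diff[OF tr[OF elim(1)] tr[OF elim(2)]] tr[OF elim(2)] by blast
      qed
    qed
    have "\<bar>LINT x|lebesgue_on \<Omega>. \<phi> x * (f' x (axis a 1) * g' x (axis b 1) - f' x (axis b 1) * g' x (axis a 1))\<bar>
        \<le> 2 * 1 * L * e * measure lborel (cball x0 (r + 1))"
    proof (rule jacobian_integral_bound[OF lf ef lg philip supp _ _ OmS suppO der])
      show "(\<lambda>x. \<phi> x * (f' x (axis a 1) * g' x (axis b 1) - f' x (axis b 1) * g' x (axis a 1)))
          \<in> borel_measurable (lebesgue_on \<Omega>)"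
        unfolding rw using ijac by (intro borel_measurable_diff) auto
    qed simp_all
    then show ?thesis
      unfolding rw Bochner_Integration.integral_diff[OF ijac ijac] by (simp add: R_def mult_ac)
  qed
  have ub: "norm (u n x $ i) \<le> C" if "x \<in> Q" for n x
  proof -
    have "norm (u n x $ i) \<le> norm (u n x)" by (rule Finite_Cartesian_Product.norm_nth_le)
    also have "\<dots> \<le> C" using that Q(5) by (intro u(2)) blast
    finally show ?thesis .
  qed
  have equi: "\<exists>d>0. \<forall>n y. y \<in> Q \<and> norm (x - y) < d \<longrightarrow> norm (u n x $ i - u n y $ i) < e"
    if x: "x \<in> Q" and e: "0 < e" for x e
  proof (intro exI[of _ "e / (L + 1)"] conjI allI impI)
    show "0 < e / (L + 1)" using e L0 by simp
    fix n y assume y: "y \<in> Q \<and> norm (x - y) < e / (L + 1)"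
    have "norm (u n x $ i - u n y $ i) \<le> L * norm (x - y)"
      using lipschitz_onD[OF lipc[of n i], of x y] Pid[OF x] Pid[of y] y by (simp add: dist_norm)
    also have "\<dots> \<le> (L + 1) * norm (x - y)" by (simp add: algebra_simps)
    also have "\<dots> < e" using y L0 by (simp add: field_simps)
    finally show "norm (u n x $ i - u n y $ i) < e" .
  qed
  \<comment> \<open>Uniform boundedness and the common Lipschitz constant yield a subsequence whose
    \<open>i\<close>-th components converge uniformly on \<open>Q\<close>, which makes
    \<open>close\<close> effective.\<close>
  obtain v :: "real^'m \<Rightarrow> real" and \<kappa> :: "nat \<Rightarrow> nat"
    where \<kappa>: "strict_mono \<kappa>"
      "\<And>e. 0 < e \<Longrightarrow> \<exists>N. \<forall>n x. n \<ge> N \<and> x \<in> Q \<longrightarrow> norm (u (\<kappa> n) x $ i - v x) < e"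
    by (rule Arzela_Ascoli[OF Q(4) ub equi]) metis+
  have "\<bar>?rhs * T - ?lhs * T\<bar> \<le> e" if e: "e > 0" for e
  proof -
    \<comment> \<open>Two members of the subsequence, each within \<open>d\<close> of
      \<open>v\<close>, differ by at most \<open>2 * d\<close>, and \<open>close\<close> multiplies
      this by \<open>R\<close>. The summand 1 keeps the denominator positive when
      \<open>R = 0\<close>.\<close>
    define d where "d = e / (2 * (R + 1))"
    have d: "d > 0" "2 * d * R \<le> e" using e R0 by (auto simp: d_def field_simps)
    obtain N where N: "\<And>n x. n \<ge> N \<Longrightarrow> x \<in> Q \<Longrightarrow> norm (u (\<kappa> n) x $ i - v x) < d"
      using \<kappa>(2)[OF d(1)] by blast
    have c: "\<bar>(LINT x|lebesgue_on \<Omega>. jac (\<kappa> p) (\<kappa> n) x) - (LINT x|lebesgue_on \<Omega>. jac (\<kappa> n) (\<kappa> n) x)\<bar> \<le> e"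
      if "p \<ge> N" "n \<ge> N" for p n
    proof -
      have "\<bar>u (\<kappa> p) x $ i - u (\<kappa> n) x $ i\<bar> \<le> 2 * d" if "x \<in> Q" for x
        using N[OF \<open>p \<ge> N\<close> that] N[OF \<open>n \<ge> N\<close> that] by auto
      from close[OF this] d(2) show ?thesis by linarith
    qed
    have "\<bar>V (\<kappa> p) - ?lhs * T\<bar> \<le> e" if "p \<ge> N" for p
    proof (rule LIMSEQ_le_const2)
      show "(\<lambda>n. \<bar>(LINT x|lebesgue_on \<Omega>. jac (\<kappa> p) (\<kappa> n) x) - (LINT x|lebesgue_on \<Omega>. jac (\<kappa> n) (\<kappa> n) x)\<bar>)
          \<longlonglongrightarrow> \<bar>V (\<kappa> p) - ?lhs * T\<bar>"
        using LIMSEQ_subseq_LIMSEQ[OF lim1 \<kappa>(1)] LIMSEQ_subseq_LIMSEQ[OF lim3 \<kappa>(1)]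
        by (intro tendsto_rabs tendsto_diff) (simp_all add: o_def)
      show "\<exists>N. \<forall>n\<ge>N. \<bar>(LINT x|lebesgue_on \<Omega>. jac (\<kappa> p) (\<kappa> n) x) - (LINT x|lebesgue_on \<Omega>. jac (\<kappa> n) (\<kappa> n) x)\<bar> \<le> e"
        using c[OF that] by blast
    qed
    then show ?thesis
      using LIMSEQ_subseq_LIMSEQ[OF lim2 \<kappa>(1)]
      by (intro LIMSEQ_le_const2[where X="\<lambda>p. \<bar>V (\<kappa> p) - ?lhs * T\<bar>"] tendsto_rabs tendsto_diff)
        (auto simp: o_def)
  qed
  then have "\<bar>?rhs * T - ?lhs * T\<bar> \<le> 0" by (rule field_le_epsilon[of _ 0, simplified])
  then show ?thesis using Tpos by simp
qed

section \<open>Supports, minors and the set \<open>K_stat g\<close>\<close>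

text \<open>Every point outside the support lies in a null set from a countable basis, and countably
  many null sets have a null union.\<close>

lemma AE_measure_support:
  fixes M :: "'a::second_countable_topology measure"
  assumes "sets M = sets borel"
  shows "AE x in M. x \<in> measure_support M"
proof -
  obtain B :: "'a set set" where B: "countable B" "topological_basis B"
    using ex_countable_basis by blast
  define B0 where "B0 = {U \<in> B. emeasure M U = 0}"
  have "(\<Union>U\<in>B0. U) \<in> null_sets M"
  proof (rule null_sets_UN')
    show "countable B0" using B(1) by (rule countable_subset[rotated]) (auto simp: B0_def)
    show "U \<in> null_sets M" if "U \<in> B0" for U
      using that topological_basis_open[OF B(2)] assms by (auto simp: B0_def null_sets_def)
  qed
  then show ?thesis
  proof (rule AE_I', safe)
    fix x assume "x \<notin> measure_support M"
    then obtain U where U: "open U" "x \<in> U" "emeasure M U = 0"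
      by (auto simp: measure_support_def)
    obtain V where V: "V \<in> B" "x \<in> V" "V \<subseteq> U"
      using topological_basisE[OF B(2) U(1,2)] by metis
    have "emeasure M V \<le> emeasure M U" using V U(1) assms by (intro emeasure_mono) auto
    then have "V \<in> B0" using V U by (simp add: B0_def)
    then show "x \<in> (\<Union>U\<in>B0. U)" using V by blast
  qed
qed

lemma exhaust_6:
  fixes x :: 6
  shows "x = 1 \<or> x = 2 \<or> x = 3 \<or> x = 4 \<or> x = 5 \<or> x = 6"
proof (induct x)
  case (of_int z)
  then have "0 \<le> z" and "z < 6" by simp_all
  \<comment> \<open>In the type \<open>6\<close> the numeral 6 equals 0, so the representative 0
    accounts for the last index.\<close>
  then have "z = 0 \<or> z = 1 \<or> z = 2 \<or> z = 3 \<or> z = 4 \<or> z = 5" by arith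
  then show ?case by auto
qed

lemma forall_6: "(\<forall>i::6. P i) \<longleftrightarrow> P 1 \<and> P 2 \<and> P 3 \<and> P 4 \<and> P 5 \<and> P 6"
  by (metis exhaust_6)

text \<open>For two columns, these minors are the Pluecker coordinates of the pair of columns; the
  quadratic relation below holds because their wedge product is decomposable.\<close>

definition row_det :: "real^2^'n \<Rightarrow> 'n \<Rightarrow> 'n \<Rightarrow> real" where
  "row_det A i k = A $ i $ 1 * A $ k $ 2 - A $ i $ 2 * A $ k $ 1"

lemma row_det_pluecker:
  "row_det A i j * row_det A k l - row_det A i k * row_det A j l + row_det A i l * row_det A j k = 0"
  unfolding row_det_def by algebra

text \<open>The parameter matrix can only be the top block, so it is eliminated. What remains are
  equations between entries and minors, which can be integrated against
  \<open>\<nu>\<close>.\<close>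

lemma mem_K_stat_iff:
  "A \<in> K_stat g \<longleftrightarrow>
     (let t = row_det A 1 2; s = deriv g t; h = s * t - g t
      in A $ 3 = s *\<^sub>R A $ 1 \<and> A $ 4 = s *\<^sub>R A $ 2
       \<and> A $ 5 $ 1 = 0 \<and> A $ 5 $ 2 = - h \<and> A $ 6 $ 1 = h \<and> A $ 6 $ 2 = 0)"
    (is "?l \<longleftrightarrow> ?r")
proof
  assume ?l
  then obtain X where X: "A = stack3 X (deriv g (det X) *\<^sub>R X)
             ((deriv g (det X) * det X - g (det X)) *\<^sub>R J_matrix)"
    by (auto simp: K_stat_def)
  have "row_det A 1 2 = det X" by (simp add: X row_det_def stack3_nth det_2)
  then show ?r by (simp add: X stack3_nth J_matrix_def Let_def)
next
  assume r: ?r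
  define X :: "real^2^2" where "X = vector [A $ 1, A $ 2]"
  have X: "X $ 1 = A $ 1" "X $ 2 = A $ 2" by (simp_all add: X_def)
  have "row_det A 1 2 = det X" by (simp add: X row_det_def det_2)
  with r have "A = stack3 X (deriv g (det X) *\<^sub>R X)
             ((deriv g (det X) * det X - g (det X)) *\<^sub>R J_matrix)"
    by (simp add: vec_eq_iff[of A] forall_6 stack3_nth J_matrix_def Let_def X)
      (simp add: vec_eq_iff forall_2)
  then show ?l by (auto simp: K_stat_def)
qed

lemma homogeneous_gradient_young_measure_row_det:
  fixes \<nu> :: "(real^2^'n) measure"
  assumes "homogeneous_gradient_young_measure \<nu>"
  shows "(LINT A|\<nu>. row_det A i k) = row_det (LINT A|\<nu>. A) i k"
    and "(LINT A|\<nu>. A $ l $ c) = (LINT A|\<nu>. A) $ l $ c"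
proof -
  have 2: "(LINT A|\<nu>. A $ l $ c) = (LINT A|\<nu>. A) $ l $ c" for l c
  proof (rule integral_bounded_linear)
    show "bounded_linear (\<lambda>A::real^2^'n. A $ l $ c)"
      using bounded_linear_compose[OF bounded_linear_vec_nth bounded_linear_vec_nth] .
    show "integrable \<nu> (\<lambda>A. A)"
      by (rule homogeneous_gradient_young_measure_integrable[OF assms]) simp
  qed
  then show "(LINT A|\<nu>. A $ l $ c) = (LINT A|\<nu>. A) $ l $ c" .
  show "(LINT A|\<nu>. row_det A i k) = row_det (LINT A|\<nu>. A) i k"
    unfolding row_det_def homogeneous_gradient_young_measure_minor[OF assms] 2 ..
qed

text \<open>The last assumption says that the variance vanishes.\<close>

lemma (in prob_space) AE_const_if_expectation_square:
  fixes f :: "'a \<Rightarrow> real"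
  assumes "integrable M f" "integrable M (\<lambda>x. (f x)\<^sup>2)" "expectation (\<lambda>x. (f x)\<^sup>2) = (expectation f)\<^sup>2"
  shows "AE x in M. f x = expectation f"
proof -
  define c where "c = expectation f"
  have i: "integrable M (\<lambda>x. (f x - c)\<^sup>2)"
    using assms by (simp add: power2_diff)
  have "expectation (\<lambda>x. (f x - c)\<^sup>2) = 0"
    using variance_eq[OF assms(1,2)] assms(3) by (simp add: c_def)
  then have "AE x in M. (f x - c)\<^sup>2 = 0"
    using integral_nonneg_eq_0_iff_AE[OF i] by simp
  then show ?thesis by eventually_elim (simp add: c_def)
qed

section \<open>The inclusion of a set in its hull\<close>

text \<open>The Dirac mass at \<open>X\<close> is generated by the constant sequence of linear maps
  \<open>X *v x\<close> on the unit ball. Its support is contained in \<open>{X}\<close>, since the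
  open complement of \<open>X\<close> has measure zero.\<close>

lemma subset_quasiconvex_hull:
  fixes K :: "(real^'m^'n) set"
  shows "K \<subseteq> quasiconvex_hull K"
proof
  fix X assume X: "X \<in> K"
  define \<nu> where "\<nu> = return borel X"
  have int: "(LINT A|\<nu>. F A) = F X"
    if "F \<in> borel_measurable borel" for F :: "real^'m^'n \<Rightarrow> 'b::{banach, second_countable_topology}"
    unfolding \<nu>_def using that by (intro integral_return) auto
  have bl: "bounded_linear ((*v) X)" by simp
  have bound: "norm (X *v x) \<le> onorm ((*v) X) * norm x" for x
    by (rule onorm[OF bl])
  have "homogeneous_gradient_young_measure \<nu>"
    unfolding homogeneous_gradient_young_measure_def
  proof (intro conjI exI[of _ "ball 0 1"] exI[of _ "\<lambda>_. (*v) X"] exI[of _ "\<lambda>_ _. X"])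
    show "prob_space \<nu>" unfolding \<nu>_def by (rule prob_space_return) simp
    show "sets \<nu> = sets borel" by (simp add: \<nu>_def)
    have "(onorm ((*v) X))-lipschitz_on (ball 0 1) ((*v) X)"
    proof (rule lipschitz_onI)
      show "dist (X *v x) (X *v y) \<le> onorm ((*v) X) * dist x y" for x y
        using bound[of "x - y"] by (simp add: dist_norm matrix_vector_mult_diff_distrib)
    qed (rule onorm_pos_le[OF bl])
    then show "\<exists>L. \<forall>j::nat. L-lipschitz_on (ball 0 1) ((*v) X)" by blast
    have "norm (X *v x) \<le> onorm ((*v) X)" if "x \<in> ball 0 1" for x
      using bound[of x] that mult_left_le[of "norm x" "onorm ((*v) X)"] onorm_pos_le[OF bl] by simp
    then show "\<exists>C. \<forall>j::nat. \<forall>x\<in>ball 0 1. norm (X *v x) \<le> C" by blast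
    show "\<forall>j::nat. is_gradient_on (ball 0 1) ((*v) X) (\<lambda>_. X)"
      unfolding is_gradient_on_def by (simp add: bounded_linear_imp_has_derivative)
    show "\<forall>F :: real^'m^'n \<Rightarrow> real. continuous_on UNIV F \<longrightarrow>
        weak_star_Linfty (ball 0 1) (\<lambda>j x. F X) (\<lambda>x. LINT A|\<nu>. F A)"
      unfolding weak_star_Linfty_def in_Linfty_def
      by (auto simp: int borel_measurable_continuous_onI intro!: exI[of _ "\<bar>F X\<bar>" for F])
  qed (auto simp: convex_ball)
  moreover have "measure_support \<nu> \<subseteq> K"
  proof
    fix A assume "A \<in> measure_support \<nu>"
    then have "emeasure \<nu> (- {X}) > 0" if "A \<noteq> X"
      using that unfolding measure_support_def by (auto dest!: spec[of _ "- {X}"])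
    then have "A = X" by (auto simp: \<nu>_def)
    with X show "A \<in> K" by simp
  qed
  moreover have "X = (LINT A|\<nu>. A)" by (simp add: int)
  ultimately show "X \<in> quasiconvex_hull K" by (auto simp: quasiconvex_hull_def)
qed

section \<open>Rigidity of gradient Young measures supported in \<open>K_stat g\<close>\<close>

theorem mainTheorem5:
  fixes g :: "real \<Rightarrow> real"
  assumes "g differentiable_on UNIV"
    and "deriv g differentiable_on UNIV"
    and "continuous_on UNIV (deriv (deriv g))"
    and "\<And>t. deriv (deriv g) t > 0"
    and "g 0 = 0" and "deriv g 0 = 0"
  shows "quasiconvex_hull (K_stat g) = K_stat g"
proof
  have dg: "(g has_real_derivative deriv g t) (at t)" for t
    using assms(1) by (simp add: differentiable_on_def DERIV_deriv_iff_real_differentiable)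
  have dg': "(deriv g has_real_derivative deriv (deriv g) t) (at t)" for t
    using assms(2) by (simp add: differentiable_on_def DERIV_deriv_iff_real_differentiable)
  define h where "h t = deriv g t * t - g t" for t
  have h0: "h 0 = 0" by (simp add: h_def assms)
  have dh: "(h has_real_derivative deriv (deriv g) t * t) (at t)" for t
    unfolding h_def[abs_def] by (auto intro!: derivative_eq_intros dg dg')
  have ch: "continuous_on S h" for S
    using DERIV_isCont[OF dh] continuous_at_imp_continuous_on by blast
  have hinc: "h x < h y" if "0 \<le> x" "x < y" for x y
  proof (rule DERIV_pos_imp_increasing_open[OF that(2) _ ch])
    show "\<exists>d. (h has_real_derivative d) (at z) \<and> 0 < d" if "x < z" "z < y" for z
      using dh assms(4) that \<open>0 \<le> x\<close> by (intro exI[of _ "deriv (deriv g) z * z"]) auto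
  qed
  have hdec: "h y < h x" if "x < y" "y \<le> 0" for x y
  proof (rule DERIV_neg_imp_decreasing_open[OF that(1) _ ch])
    show "\<exists>d. (h has_real_derivative d) (at z) \<and> d < 0" if "x < z" "z < y" for z
      using dh assms(4) that \<open>y \<le> 0\<close> by (intro exI[of _ "deriv (deriv g) z * z"]) (auto simp: mult_pos_neg)
  qed
  have sinc: "deriv g x < deriv g y" if "x < y" for x y
    by (rule DERIV_pos_imp_increasing[OF that]) (use dg' assms(4) in blast)
  show "quasiconvex_hull (K_stat g) \<subseteq> K_stat g"
  proof
    fix X assume "X \<in> quasiconvex_hull (K_stat g)"
    then obtain \<nu> where \<nu>: "homogeneous_gradient_young_measure \<nu>"
      and supp: "measure_support \<nu> \<subseteq> K_stat g" and X: "X = (LINT A|\<nu>. A)"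
      by (auto simp: quasiconvex_hull_def)
    interpret prob_space \<nu> using \<nu> by (simp add: homogeneous_gradient_young_measure_def)
    have sets: "sets \<nu> = sets borel" using \<nu> by (simp add: homogeneous_gradient_young_measure_def)
    note int = homogeneous_gradient_young_measure_integrable[OF \<nu>]
    note mean = homogeneous_gradient_young_measure_row_det[OF \<nu>, folded X]
    have c: "continuous_on UNIV (\<lambda>A::real^2^6. A $ i $ a)" for i a
      by (intro continuous_intros)
    have crd: "continuous_on UNIV (\<lambda>A::real^2^6. row_det A i k)" for i k
      unfolding row_det_def by (intro continuous_intros)
    note [measurable] = borel_measurable_integrable[OF int[OF crd]] borel_measurable_integrable[OF int[OF c]]
    define t where "t A = row_det A 1 2" for A :: "real^2^6"
    have [measurable]: "t \<in> borel_measurable \<nu>" unfolding t_def by measurable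
    have K: "AE A in \<nu>. A $ 3 = deriv g (t A) *\<^sub>R A $ 1 \<and> A $ 4 = deriv g (t A) *\<^sub>R A $ 2
       \<and> A $ 5 $ 1 = 0 \<and> A $ 5 $ 2 = - h (t A) \<and> A $ 6 $ 1 = h (t A) \<and> A $ 6 $ 2 = 0"
      using AE_measure_support[OF sets]
    proof eventually_elim
      case (elim A)
      with supp have "A \<in> K_stat g" by blast
      then show ?case by (simp add: mem_K_stat_iff Let_def t_def h_def)
    qed
    \<comment> \<open>The relations within the third block are linear, so they pass to the
      barycenter.\<close>
    have X5: "X $ 5 $ 1 = 0" and X6: "X $ 6 $ 2 = 0" and X56: "X $ 5 $ 2 = - X $ 6 $ 1"
    proof -
      have "(LINT A|\<nu>. A $ 5 $ 1) = (LINT A|\<nu>. 0)"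
        by (rule integral_cong_AE; measurable) (use K in eventually_elim, simp)
      then show "X $ 5 $ 1 = 0" by (simp add: mean)
      have "(LINT A|\<nu>. A $ 6 $ 2) = (LINT A|\<nu>. 0)"
        by (rule integral_cong_AE; measurable) (use K in eventually_elim, simp)
      then show "X $ 6 $ 2 = 0" by (simp add: mean)
      have "(LINT A|\<nu>. A $ 5 $ 2) = (LINT A|\<nu>. - A $ 6 $ 1)"
        by (rule integral_cong_AE; measurable) (use K in eventually_elim, simp)
      then show "X $ 5 $ 2 = - X $ 6 $ 1" by (simp add: mean)
    qed
    \<comment> \<open>Both on the support and at the barycenter, the minor of rows 5 and 6 is the
      square of the entry in row 6, column 1. Commutation of minors with the mean thus gives this
      entry zero variance.\<close>
    have "(LINT A|\<nu>. row_det A 5 6) = (LINT A|\<nu>. (A $ 6 $ 1)\<^sup>2)"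
      by (rule integral_cong_AE; measurable)
        (use K in eventually_elim, simp add: row_det_def power2_eq_square)
    moreover have "row_det X 5 6 = (X $ 6 $ 1)\<^sup>2"
      by (simp add: row_det_def X5 X56 power2_eq_square)
    moreover have "continuous_on UNIV (\<lambda>A::real^2^6. (A $ 6 $ 1)\<^sup>2)" by (intro continuous_intros)
    ultimately have "AE A in \<nu>. A $ 6 $ 1 = X $ 6 $ 1"
      using AE_const_if_expectation_square[OF int[OF c, of 6 1]] by (simp add: mean int)
    then have level: "AE A in \<nu>. h (t A) = X $ 6 $ 1"
      using K by eventually_elim simp
    have "\<exists>\<tau>. AE A in \<nu>. t A = \<tau>"
    proof (cases "X $ 6 $ 1 = 0")
      case True
      have "x = 0" if "h x = 0" for x
        using hinc[of 0 x] hdec[of x 0] that h0 by (cases "x < 0"; cases "x > 0") auto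
      then have "AE A in \<nu>. t A = 0"
        using level[unfolded True] by (rule eventually_mono[rotated])
      then show ?thesis ..
    next
      case False
      have "\<exists>a>0. \<forall>x>0. h x = X $ 6 $ 1 \<longrightarrow> x = a"
      proof (cases "\<exists>x>0. h x = X $ 6 $ 1")
        case True
        then obtain y where y: "y > 0" "h y = X $ 6 $ 1" by blast
        have "x = y" if "x > 0" "h x = X $ 6 $ 1" for x
          using hinc[of x y] hinc[of y x] that y by (cases x y rule: linorder_cases) auto
        with y(1) show ?thesis by blast
      next
        case False
        \<comment> \<open>If the level has no positive point, the uniqueness claim is vacuous. The
          default 1 preserves \<open>a > 0\<close>, used in the final sign argument; -1 does the
          same for \<open>b\<close> below.\<close>
        then show ?thesis by (intro exI[of _ "1"]) auto
      qed
      then obtain a where a: "a > 0" "\<And>x. x > 0 \<Longrightarrow> h x = X $ 6 $ 1 \<Longrightarrow> x = a" by blast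
      have "\<exists>b<0. \<forall>x<0. h x = X $ 6 $ 1 \<longrightarrow> x = b"
      proof (cases "\<exists>x<0. h x = X $ 6 $ 1")
        case True
        then obtain y where y: "y < 0" "h y = X $ 6 $ 1" by blast
        have "x = y" if "x < 0" "h x = X $ 6 $ 1" for x
          using hdec[of x y] hdec[of y x] that y by (cases x y rule: linorder_cases) auto
        with y(1) show ?thesis by blast
      next
        case False
        then show ?thesis by (intro exI[of _ "- 1"]) auto
      qed
      then obtain b where b: "b < 0" "\<And>x. x < 0 \<Longrightarrow> h x = X $ 6 $ 1 \<Longrightarrow> x = b" by blast
      have tab: "AE A in \<nu>. t A = (if t A > 0 then a else b)"
        using level
      proof eventually_elim
        case (elim A)
        with False h0 have "t A \<noteq> 0" by auto
        then show ?case using a(2)[OF _ elim] b(2)[OF _ elim] by auto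
      qed
      define p where "p = prob {A \<in> space \<nu>. t A > 0}"
      \<comment> \<open>Almost surely \<open>t\<close> takes the value \<open>a\<close> with
        probability \<open>p\<close> and \<open>b\<close> otherwise, so the mean of any function of
        \<open>t\<close> is explicit. It applies to every minor that depends on \<open>A\<close>
        through \<open>t\<close> alone, and that mean is the minor of \<open>X\<close>.\<close>
      have E: "row_det X i k = F b + (F a - F b) * p"
        if "AE A in \<nu>. row_det A i k = F (t A)" for i k and F :: "real \<Rightarrow> real"
      proof -
        define pos :: "real^2^6 \<Rightarrow> real" where "pos = indicator {A \<in> space \<nu>. t A > 0}"
        have [measurable]: "pos \<in> borel_measurable \<nu>" unfolding pos_def by measurable
        have ipos: "integrable \<nu> pos" by (rule integrable_const_bound[of _ 1]) (auto simp: pos_def)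
        have "(LINT A|\<nu>. row_det A i k) = (LINT A|\<nu>. F b + (F a - F b) * pos A)"
        proof (rule integral_cong_AE)
          show "AE A in \<nu>. row_det A i k = F b + (F a - F b) * pos A"
            using that tab AE_space by eventually_elim (auto simp: pos_def split: if_splits)
        qed measurable
        also have "\<dots> = F b + (F a - F b) * p"
          using ipos by (simp add: prob_space) (simp add: pos_def p_def)
        finally show ?thesis by (simp add: mean)
      qed
      define \<alpha> where "\<alpha> = deriv g a"
      define \<beta> where "\<beta> = deriv g b"
      have \<alpha>\<beta>: "\<alpha> > 0" "\<beta> < 0"
        using sinc[OF a(1)] sinc[OF b(1)] by (simp_all add: \<alpha>_def \<beta>_def assms)
      have r12: "row_det X 1 2 = b + (a - b) * p"
        by (rule E) (simp add: t_def)
      have r14: "row_det X 1 4 = \<beta> * b + (\<alpha> * a - \<beta> * b) * p" unfolding \<alpha>_def \<beta>_def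
        by (rule E) (use K in eventually_elim, simp add: t_def row_det_def algebra_simps)
      have r32: "row_det X 3 2 = \<beta> * b + (\<alpha> * a - \<beta> * b) * p" unfolding \<alpha>_def \<beta>_def
        by (rule E) (use K in eventually_elim, simp add: t_def row_det_def algebra_simps)
      have r34: "row_det X 3 4 = \<beta>\<^sup>2 * b + (\<alpha>\<^sup>2 * a - \<beta>\<^sup>2 * b) * p" unfolding \<alpha>_def \<beta>_def
        by (rule E[of _ _ "\<lambda>t. (deriv g t)\<^sup>2 * t"])
          (use K in eventually_elim, simp add: t_def row_det_def power2_eq_square algebra_simps)
      have r13: "row_det X 1 3 = 0"
        by (rule E[of _ _ "\<lambda>t. 0", simplified]) (use K in eventually_elim, simp add: row_det_def)
      have r23: "row_det X 2 3 = - row_det X 3 2" by (simp add: row_det_def)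
      \<comment> \<open>On the support, row 3 is a multiple of row 1, so the minor of rows 1 and 3
        has mean zero. This removes the middle term of the Pluecker relation, and \<open>r14\<close>
        and \<open>r32\<close> have the same value.\<close>
      have "row_det X 1 2 * row_det X 3 4 = (row_det X 3 2)\<^sup>2"
        using row_det_pluecker[of X 1 2 3 4] unfolding r13 r23 r14[folded r32] by algebra
      \<comment> \<open>With weights \<open>p\<close> and \<open>1 - p\<close>, the defect in the
        preceding identity is exactly this product. As \<open>b < 0 < a\<close> and
        \<open>\<beta> < 0 < \<alpha>\<close>, only the factors in \<open>p\<close> can
        vanish.\<close>
      then have "p * (1 - p) * (a * b * (\<alpha> - \<beta>)\<^sup>2) = 0"
        unfolding r12 r32 r34 by algebra
      then have "p = 0 \<or> p = 1" using a b \<alpha>\<beta> by auto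
      then show ?thesis
      proof
        assume "p = 0"
        then have "AE A in \<nu>. \<not> t A > 0"
          unfolding p_def by (subst (asm) prob_Collect_eq_0) auto
        with tab have "AE A in \<nu>. t A = b" by eventually_elim auto
        then show ?thesis ..
      next
        assume "p = 1"
        then have "AE A in \<nu>. t A > 0"
          unfolding p_def by (subst (asm) prob_Collect_eq_1) auto
        with tab have "AE A in \<nu>. t A = a" by eventually_elim auto
        then show ?thesis ..
      qed
    qed
    then obtain \<tau> where \<tau>: "AE A in \<nu>. t A = \<tau>" ..
    \<comment> \<open>Since minors commute with the mean, the constant \<open>\<tau>\<close> is also
      the top determinant of \<open>X\<close>. With \<open>t\<close> frozen at
      \<open>\<tau>\<close>, the remaining relations have constant coefficients and can be averaged
      entry by entry.\<close>
    have "(LINT A|\<nu>. t A) = (LINT A|\<nu>. \<tau>)" by (rule integral_cong_AE; measurable) (rule \<tau>)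
    then have d: "row_det X 1 2 = \<tau>" by (simp add: t_def mean prob_space)
    have X3: "X $ 3 $ k = deriv g \<tau> * X $ 1 $ k" for k
    proof -
      have "(LINT A|\<nu>. A $ 3 $ k) = (LINT A|\<nu>. deriv g \<tau> * A $ 1 $ k)"
        by (rule integral_cong_AE; measurable) (use K \<tau> in eventually_elim, simp)
      then show ?thesis by (simp add: mean)
    qed
    have X4: "X $ 4 $ k = deriv g \<tau> * X $ 2 $ k" for k
    proof -
      have "(LINT A|\<nu>. A $ 4 $ k) = (LINT A|\<nu>. deriv g \<tau> * A $ 2 $ k)"
        by (rule integral_cong_AE; measurable) (use K \<tau> in eventually_elim, simp)
      then show ?thesis by (simp add: mean)
    qed
    have "(LINT A|\<nu>. A $ 6 $ 1) = (LINT A|\<nu>. h \<tau>)"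
      by (rule integral_cong_AE; measurable) (use K \<tau> in eventually_elim, simp)
    then have X61: "X $ 6 $ 1 = h \<tau>" by (simp add: mean prob_space)
    show "X \<in> K_stat g"
      unfolding mem_K_stat_iff Let_def d
      using X3 X4 X5 X6 X56 X61 by (simp add: vec_eq_iff h_def)
  qed
  show "K_stat g \<subseteq> quasiconvex_hull (K_stat g)"
    by (rule subset_quasiconvex_hull)
qed

end
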